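(* Let $S:\mathbb{R}\rightarrow\mathbb{R}$ be a subadditive locally bounded function and let $\mathbb{A}$ be any non-trivial additive subgroup of $\mathbb{R}$ such that $S|\mathbb{A}$ is additive. Then $S|\mathbb{A}$ is linear. In particular, if $\mathbb{A}$ is a dense additive subgroup of $\mathbb{R}$, then any additive function $G:\mathbb{A}\to\mathbb{R}$ has at most one continuous subadditive extension $S:\mathbb{R}\rightarrow\mathbb{R}$.
   Context: $S$ is subadditive if $S(x+y)\le S(x)+S(y)$ for all $x,y\in\mathbb{R}$. Locally bounded means bounded on some neighbourhood of each point. A function $G$ on $\mathbb{A}$ is additive if $G(a+b)=G(a)+G(b)$ for all $a,b\in\mathbb{A}$, and linear if there is $c\in\mathbb{R}$ with $G(a)=ca$ for all $a\in\mathbb{A}$. *)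

theory Defs
  imports "HOL-Analysis.Analysis"
begin

definition real_subadditive :: "(real \<Rightarrow> real) \<Rightarrow> bool" where
  "real_subadditive S \<longleftrightarrow> (\<forall>x y. S (x + y) \<le> S x + S y)"

definition locally_bounded :: "(real \<Rightarrow> real) \<Rightarrow> bool" where
  "locally_bounded S \<longleftrightarrow> (\<forall>x. \<exists>U. open U \<and> x \<in> U \<and> bounded (S ` U))"

definition real_subgroup :: "real set \<Rightarrow> bool" where
  "real_subgroup A \<longleftrightarrow>
     0 \<in> A \<and> (\<forall>a\<in>A. \<forall>b\<in>A. a + b \<in> A) \<and> (\<forall>a\<in>A. - a \<in> A)"

(* A function on a subgroup A is represented by a total function whose values outside A are
   ignored: the predicates below inspect values on A only. *)

definition additive_on :: "real set \<Rightarrow> (real \<Rightarrow> real) \<Rightarrow> bool" where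
  "additive_on A G \<longleftrightarrow> (\<forall>a\<in>A. \<forall>b\<in>A. G (a + b) = G a + G b)"

definition real_linear_on :: "real set \<Rightarrow> (real \<Rightarrow> real) \<Rightarrow> bool" where
  "real_linear_on A G \<longleftrightarrow> (\<exists>c. \<forall>a\<in>A. G a = c * a)"

definition extends_from :: "real set \<Rightarrow> (real \<Rightarrow> real) \<Rightarrow> (real \<Rightarrow> real) \<Rightarrow> bool" where
  "extends_from A G S \<longleftrightarrow> (\<forall>a\<in>A. S a = G a)"

end

(* Fix a nonzero b in A and put c = S b / b. Division with remainder by b writes n * a, for a in A,
   as an integer multiple of b plus a remainder r in A with |r| <= |b|, so additivity gives
   n * (S a - c * a) = S r - c * r. The right-hand side is bounded in n because S is bounded on
   compact sets, which forces S a = c * a.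
   Two continuous extensions agree on the dense set A, hence everywhere. *)
theory Submission
  imports Defs
begin

text \<open>Compactness leaves finitely many of the neighbourhoods on which \<open>S\<close> is
  bounded, and a finite union of bounded sets is bounded.\<close>

lemma locally_bounded_imp_bounded_compact:
  assumes "locally_bounded S" "compact K"
  shows "bounded (S ` K)"
proof -
  obtain U where U: "\<And>x. open (U x)" "\<And>x. x \<in> U x" "\<And>x. bounded (S ` U x)"
    using assms(1) unfolding locally_bounded_def by metis
  obtain C where C: "C \<subseteq> K" "finite C" "K \<subseteq> (\<Union>x\<in>C. U x)"
    using compactE_image[OF assms(2), of K U] U by blast
  have "bounded (\<Union>x\<in>C. S ` U x)"
    using C U by blast
  then show ?thesis
    by (rule bounded_subset) (use C in blast)
qed

text \<open>Membership and value are proved together because additivity may be applied only to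
  points already known to lie in \<open>A\<close>.\<close>

lemma additive_on_scale:
  assumes A: "real_subgroup A" and S: "additive_on A S" and a: "a \<in> A"
  shows "of_int k * a \<in> A \<and> S (of_int k * a) = of_int k * S a"
proof -
  have S0: "S 0 = 0"
    using A S unfolding real_subgroup_def additive_on_def by (metis add_cancel_right_right)
  have uminus: "- x \<in> A \<and> S (- x) = - S x" if "x \<in> A" for x
  proof -
    have "- x \<in> A"
      using A that unfolding real_subgroup_def by blast
    moreover have "S (x + - x) = S x + S (- x)"
      using S that calculation unfolding additive_on_def by blast
    ultimately show ?thesis
      using S0 by simp
  qed
  have nat: "of_nat n * a \<in> A \<and> S (of_nat n * a) = of_nat n * S a" for n
  proof (induction n)
    case 0
    then show ?case
      using A S0 by (simp add: real_subgroup_def)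
  next
    case (Suc n)
    then show ?case
      using A S a by (simp add: real_subgroup_def additive_on_def distrib_right)
  qed
  show ?thesis
  proof (cases k)
    case (nonneg n)
    then show ?thesis
      using nat[of n] by simp
  next
    case (neg n)
    then show ?thesis
      using uminus[of "of_nat (Suc n) * a"] nat[of "Suc n"]
      by (simp del: of_nat_Suc)
  qed
qed

lemma bounded_multiples_imp_zero:
  fixes x :: real
  assumes "\<And>n::nat. \<bar>real n * x\<bar> \<le> K"
  shows "x = 0"
proof (rule ccontr)
  assume "x \<noteq> 0"
  then obtain n :: nat where "K < real n * \<bar>x\<bar>"
    using reals_Archimedean3[of "\<bar>x\<bar>"] by auto
  then show False
    using assms[of n] by (simp add: abs_mult)
qed

lemma locally_bounded_additive_on_imp_linear_on:
  assumes S: "locally_bounded S" and A: "real_subgroup A" and add: "additive_on A S"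
  shows "real_linear_on A S"
\<comment> \<open>A subgroup inside \<open>{0}\<close> offers no nonzero \<open>b\<close> to divide
  by; there \<open>S 0 = 0\<close> and any slope fits.\<close>
proof (cases "A \<subseteq> {0}")
  case True
  have "S 0 = 0"
    using additive_on_scale[OF A add, of 0 0] A by (simp add: real_subgroup_def)
  with True show ?thesis
    by (force simp: real_linear_on_def)
next
  case False
  then obtain b where b: "b \<in> A" "b \<noteq> 0"
    by auto
  define c where "c = S b / b"
  have Sb: "S b = c * b"
    using b by (simp add: c_def)
  \<comment> \<open>This interval contains every remainder modulo \<open>b\<close>, so
    \<open>B\<close> can be fixed before \<open>n\<close> is chosen.\<close>
  obtain B where B: "\<And>x. x \<in> {-\<bar>b\<bar>..\<bar>b\<bar>} \<Longrightarrow> \<bar>S x\<bar> \<le> B"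
    using locally_bounded_imp_bounded_compact[OF S compact_Icc, of "-\<bar>b\<bar>" "\<bar>b\<bar>"]
    unfolding bounded_iff real_norm_def by blast
  have "S a = c * a" if a: "a \<in> A" for a
  proof -
    have "\<bar>real n * (S a - c * a)\<bar> \<le> B + \<bar>c\<bar> * \<bar>b\<bar>" for n
    proof -
      define m where "m = \<lfloor>real n * a / b\<rfloor>"
      \<comment> \<open>Writing the remainder as a sum of two elements of \<open>A\<close> lets
        additivity of \<open>S\<close> apply to it directly.\<close>
      define r where "r = real n * a + of_int (- m) * b"
      have na: "real n * a \<in> A" "S (real n * a) = real n * S a"
        using additive_on_scale[OF A add a, of "int n"] by simp_all
      have mb: "of_int (- m) * b \<in> A" "S (of_int (- m) * b) = of_int (- m) * S b"
        using additive_on_scale[OF A add b(1), of "- m"] by blast+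
      have Sr: "S r = real n * S a + of_int (- m) * S b"
        using add na mb unfolding r_def additive_on_def by metis
      \<comment> \<open>This holds for either sign of \<open>b\<close>; as the fractional part lies
        in [0, 1), it bounds the remainder.\<close>
      have "r = frac (real n * a / b) * b"
        using b by (simp add: r_def m_def frac_def field_simps)
      then have r: "\<bar>r\<bar> \<le> \<bar>b\<bar>"
        using frac_lt_1[of "real n * a / b"] mult_left_le_one_le[of "\<bar>b\<bar>" "frac (real n * a / b)"]
        by (simp add: abs_mult)
      \<comment> \<open>The choice of \<open>c\<close> makes \<open>S x - c * x\<close> vanish at
        \<open>b\<close>, so the multiple of \<open>b\<close> cancels. \<open>Sr\<close> is
        rewritten before \<open>r_def\<close> so that \<open>S r\<close> is still visible.\<close>
      have "real n * (S a - c * a) = S r - c * r"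
        unfolding Sr Sb unfolding r_def by (simp add: algebra_simps)
      moreover have "\<bar>S r\<bar> \<le> B"
        using B[of r] r by (simp add: abs_le_iff)
      moreover have "\<bar>c * r\<bar> \<le> \<bar>c\<bar> * \<bar>b\<bar>"
        using r by (simp add: abs_mult mult_left_mono)
      ultimately show ?thesis
        by linarith
    qed
    then have "S a - c * a = 0"
      by (rule bounded_multiples_imp_zero)
    then show ?thesis
      by simp
  qed
  then show ?thesis
    unfolding real_linear_on_def by blast
qed

text \<open>The set where two continuous real functions agree is closed, so containing
  \<open>A\<close> forces it to contain the closure of \<open>A\<close>.\<close>

lemma continuous_extends_from_unique:
  assumes A: "closure A = UNIV"
    and S: "continuous_on UNIV S" "extends_from A G S"
    and T: "continuous_on UNIV T" "extends_from A G T"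
  shows "S = T"
proof -
  have "closed {x. S x = T x}"
    using S(1) T(1) by (rule closed_Collect_eq)
  moreover have "A \<subseteq> {x. S x = T x}"
    using S(2) T(2) by (auto simp: extends_from_def)
  ultimately have "closure A \<subseteq> {x. S x = T x}"
    by (rule closure_minimal[rotated])
  then show ?thesis
    using A by auto
qed

theorem theorem2:
  shows "(\<forall>(S :: real \<Rightarrow> real) (A :: real set).
            real_subadditive S \<and> locally_bounded S \<and>
            real_subgroup A \<and> A \<noteq> {0} \<and> additive_on A S
            \<longrightarrow> real_linear_on A S)
       \<and> (\<forall>(A :: real set) (G :: real \<Rightarrow> real).
            real_subgroup A \<and> closure A = UNIV \<and> additive_on A G
            \<longrightarrow> (\<exists>\<^sub>\<le>\<^sub>1 S :: real \<Rightarrow> real.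
                  continuous_on UNIV S \<and> real_subadditive S \<and> extends_from A G S))"
  using locally_bounded_additive_on_imp_linear_on continuous_extends_from_unique
  unfolding Uniq_def by blast

end
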